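(* Let $(X,\lambda)$ be a descending type weighted polyhedron and $R$ a commutative ring with unit. For any cohomology classes $[\phi]\in\mathcal H^p_W(X,\lambda;R)$, $[\psi]\in\mathcal H^q_W(X,\lambda;R)$ and any homology class $[\theta]\in\mathcal H^W_n(X,\lambda;R)$ with $p+q\le n$, $$([\theta]\Cap[\phi])\Cap[\psi]=[\theta]\Cap([\phi]\Cup[\psi]).$$
   Context: A descending weight on a simplicial complex $K$ is a function $\mu$ assigning a positive integer to each simplex with $\mu(\sigma)\mid\mu(\sigma')$ whenever $\sigma'$ is a face of $\sigma$. It is divisible if the vertices of every simplex can be ordered $v_0,\dots,v_k$ with $\mu(v_0)\mid\cdots\mid\mu(v_k)$ and the weight of that simplex is $\mu(v_0)$. On the geometric realization $|K|\subseteq\mathbb R^N$ put $\lambda_\mu(x)=\mu(\mathrm{Car}_K(x))$, where $\mathrm{Car}_K(x)$ is the unique simplex containing $x$ in the relative interior of its realization. A descending type weighted polyhedron is a pair $(X,\lambda)$, $X$ a topological space, $\lambda:X\to\mathbb Z_+$, for which there is a homeomorphism $X\to|K|$ carrying $\lambda$ to $\lambda_\mu$ for some descending weight $\mu$ on some simplicial complex $K$. A weighted singular $n$-simplex $\theta:(|\Delta^n|,\lambda_\xi)\to(X,\lambda)$ is a continuous map $\theta:|\Delta^n|\to X$ together with a divisible descending weight $\xi$ on the standard simplex $\Delta^n=[v_0,\dots,v_n]$ such that $\lambda_\xi(x)\mid\lambda(\theta(x))$ for all $x$. Restriction to faces (with restricted weight) gives weighted singular simplices. $\mathcal W_n(X,\lambda)$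 is the free abelian group on these, with $\partial^\lambda\theta=\sum_{j=0}^n(-1)^j\frac{\xi(\partial_j\Delta^n)}{\xi(\Delta^n)}\,\theta|_{\partial_j\Delta^n}$, $\partial_j\Delta^n=[v_0,\dots,\widehat{v_j},\dots,v_n]\cong\Delta^{n-1}$. Put $\mathcal W_*(X,\lambda;R)=\mathcal W_*(X,\lambda)\otimes R$ with homology $\mathcal H^W_*(X,\lambda;R)$, and $\mathcal W^*(X,\lambda;R)=\mathrm{Hom}(\mathcal W_*(X,\lambda),R)$, $\delta^\lambda\phi=\phi\circ\partial^\lambda$, with cohomology $\mathcal H_W^*(X,\lambda;R)$. Weighted cup product: for $\phi\in\mathcal W^p$, $\psi\in\mathcal W^q$, $$(\phi\Cup\psi)(\theta)=\frac{\xi([v_0,\dots,v_p])\xi([v_p,\dots,v_{p+q}])}{\xi([v_0,\dots,v_{p+q}])}\phi(\theta|_{[v_0,\dots,v_p]})\,\psi(\theta|_{[v_p,\dots,v_{p+q}]}).$$ Weighted cap product ($R$-bilinear, $0\le p\le n$): for a weighted singular $n$-simplex $\theta:(|\Delta^n|,\lambda_\xi)\to(X,\lambda)$ and $\phi\in\mathcal W^p(X,\lambda;R)$, $$\theta\Cap\phi=\frac{\xi([v_0,\dots,v_p])\xi([v_p,\dots,v_n])}{\xi([v_0,\dots,v_n])}\,\phi(\theta|_{[v_0,\dots,v_p]})\,\theta|_{[v_p,\dots,v_n]}\in\mathcal W_{n-p}(X,\lambda;R).$$ They satisfy $\delta^\lambda(\phi\Cup\psi)=\delta^\lambda\phi\Cup\psi+(-1)^p\phi\Cup\delta^\lambda\psi$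 and $\partial^\lambda(\theta\Cap\phi)=(-1)^p(\partial^\lambda\theta\Cap\phi-\theta\Cap\delta^\lambda\phi)$, and hence induce products $\Cup$ on $\mathcal H^*_W(X,\lambda;R)$ and $\Cap:\mathcal H^W_n(X,\lambda;R)\times\mathcal H^p_W(X,\lambda;R)\to\mathcal H^W_{n-p}(X,\lambda;R)$. *)

theory Defs
  imports "HOL-Analysis.Polytope" "HOL-Homology.Homology"
begin

section \<open>Weights on simplicial complexes\<close>

text \<open>
  An abstract simplex is the set of its vertices, and a complex is a set of simplices; the empty
  set is not a simplex. The predicates below serve both for geometric complexes (whose vertices
  are points of a Euclidean space) and for the standard simplex (whose vertices are numbers).
\<close>

definition descending_weight :: "'v set set \<Rightarrow> ('v set \<Rightarrow> nat) \<Rightarrow> bool" where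
  "descending_weight K \<mu> \<longleftrightarrow>
     (\<forall>\<sigma>\<in>K. 0 < \<mu> \<sigma>) \<and> (\<forall>\<sigma>\<in>K. \<forall>\<tau>\<in>K. \<tau> \<subseteq> \<sigma> \<longrightarrow> \<mu> \<sigma> dvd \<mu> \<tau>)"

definition divisible_weight :: "'v set set \<Rightarrow> ('v set \<Rightarrow> nat) \<Rightarrow> bool" where
  "divisible_weight K \<mu> \<longleftrightarrow>
     (\<forall>\<sigma>\<in>K. \<exists>vs. distinct vs \<and> set vs = \<sigma> \<and>
        sorted_wrt (\<lambda>v w. \<mu> {v} dvd \<mu> {w}) vs \<and> \<mu> \<sigma> = \<mu> {hd vs})"

text \<open>
  The function \<open>\<lambda>\<^sub>\<mu>\<close>: \<open>ri \<sigma>\<close> is the relative interior of the realization of the simplex \<open>\<sigma>\<close>,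
  and the description selects the carrier of \<open>x\<close>.
\<close>

definition weight_function ::
  "'v set set \<Rightarrow> ('v set \<Rightarrow> 'b set) \<Rightarrow> ('v set \<Rightarrow> nat) \<Rightarrow> 'b \<Rightarrow> nat" where
  "weight_function K ri \<mu> x = \<mu> (THE \<sigma>. \<sigma> \<in> K \<and> x \<in> ri \<sigma>)"

text \<open>Simplicial complexes realized in a Euclidean space, not required to be finite.\<close>

definition geometric_complex :: "'v::euclidean_space set set \<Rightarrow> bool" where
  "geometric_complex K \<longleftrightarrow>
     (\<forall>\<sigma>\<in>K. finite \<sigma> \<and> \<sigma> \<noteq> {} \<and> \<not> affine_dependent \<sigma>) \<and>
     (\<forall>\<sigma>\<in>K. \<forall>\<tau>. \<tau> \<noteq> {} \<and> \<tau> \<subseteq> \<sigma> \<longrightarrow> \<tau> \<in> K) \<and>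
     (\<forall>\<sigma>\<in>K. \<forall>\<tau>\<in>K. (convex hull \<sigma> \<inter> convex hull \<tau>) face_of (convex hull \<sigma>) \<and>
                    (convex hull \<sigma> \<inter> convex hull \<tau>) face_of (convex hull \<tau>))"

definition realization :: "'v::euclidean_space set set \<Rightarrow> 'v set" where
  "realization K = (\<Union>\<sigma>\<in>K. convex hull \<sigma>)"

text \<open>
  The type argument is the ambient Euclidean space of the complex. A statement assuming this
  predicate for an arbitrary \<open>'v::euclidean_space\<close> covers every ambient dimension.
\<close>

definition descending_weighted_polyhedron ::
  "'v::euclidean_space itself \<Rightarrow> 'a topology \<Rightarrow> ('a \<Rightarrow> nat) \<Rightarrow> bool" where
  "descending_weighted_polyhedron T X lam \<longleftrightarrow>
     (\<exists>(K :: 'v set set) \<mu> h.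
        geometric_complex K \<and> descending_weight K \<mu> \<and>
        homeomorphic_map X (top_of_set (realization K)) h \<and>
        (\<forall>x\<in>topspace X.
           lam x = weight_function K (\<lambda>\<sigma>. rel_interior (convex hull \<sigma>)) \<mu> (h x)))"


section \<open>Weighted singular simplices\<close>

definition std_faces :: "nat \<Rightarrow> nat set set" where
  "std_faces n = {S. S \<noteq> {} \<and> S \<subseteq> {..n}}"

text \<open>
  \<open>standard_simplex n\<close> consists of functions \<open>nat \<Rightarrow> real\<close>, a type without \<open>rel_interior\<close>; the
  relative interior of the face spanned by \<open>S\<close> is the set of points whose barycentric
  coordinates with respect to \<open>S\<close> are all positive.
\<close>

definition std_rel_interior :: "nat set \<Rightarrow> (nat \<Rightarrow> real) set" where
  "std_rel_interior S = {x. (\<forall>i\<in>S. 0 < x i) \<and> (\<forall>i. i \<notin> S \<longrightarrow> x i = 0) \<and> (\<Sum>i\<in>S. x i) = 1}"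

text \<open>
  A pair \<open>(\<theta>, \<xi>)\<close> of a map and a weight; both are extensional, so that equal weighted
  singular simplices are equal pairs.
\<close>

type_synonym 'a wsimplex = "((nat \<Rightarrow> real) \<Rightarrow> 'a) \<times> (nat set \<Rightarrow> nat)"

definition weighted_simplex :: "nat \<Rightarrow> 'a topology \<Rightarrow> ('a \<Rightarrow> nat) \<Rightarrow> 'a wsimplex \<Rightarrow> bool" where
  "weighted_simplex n X lam s \<longleftrightarrow>
     (case s of (\<theta>, \<xi>) \<Rightarrow>
        singular_simplex n X \<theta> \<and>
        \<xi> \<in> extensional (std_faces n) \<and>
        descending_weight (std_faces n) \<xi> \<and> divisible_weight (std_faces n) \<xi> \<and>
        (\<forall>x\<in>standard_simplex n.
           weight_function (std_faces n) std_rel_interior \<xi> x dvd lam (\<theta> x)))"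

text \<open>
  Restriction of a weighted singular simplex to the face \<open>[v\<^bsub>g 0\<^esub>, \<dots>, v\<^bsub>g m\<^esub>]\<close>, where \<open>g\<close> is strictly
  increasing on \<open>{..m}\<close>; the face is identified with \<open>\<Delta>\<^sup>m\<close> by the affine map sending the
  vertex \<open>v\<^sub>j\<close> to \<open>v\<^bsub>g j\<^esub>\<close>.
\<close>

definition wface :: "nat \<Rightarrow> (nat \<Rightarrow> nat) \<Rightarrow> 'a wsimplex \<Rightarrow> 'a wsimplex" where
  "wface m g s =
     (simplex_map m (fst s) (oriented_simplex m (\<lambda>j i. if i = g j then 1 else 0)),
      restrict (\<lambda>S. snd s (g ` S)) (std_faces m))"

text \<open>For an \<open>n\<close>-simplex: the faces \<open>\<partial>\<^sub>j\<Delta>\<^sup>n\<close>, \<open>[v\<^sub>0, \<dots>, v\<^sub>p]\<close> and \<open>[v\<^sub>p, \<dots>, v\<^sub>n]\<close>.\<close>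

definition opposite_face :: "nat \<Rightarrow> nat \<Rightarrow> 'a wsimplex \<Rightarrow> 'a wsimplex" where
  "opposite_face n j = wface (n - 1) (\<lambda>i. if i < j then i else Suc i)"

definition front_face :: "nat \<Rightarrow> 'a wsimplex \<Rightarrow> 'a wsimplex" where
  "front_face p = wface p (\<lambda>i. i)"

definition back_face :: "nat \<Rightarrow> nat \<Rightarrow> 'a wsimplex \<Rightarrow> 'a wsimplex" where
  "back_face n p = wface (n - p) (\<lambda>i. p + i)"


section \<open>Weighted singular homology\<close>

text \<open>
  \<open>\<W>\<^sub>n(X, \<lambda>) \<otimes> R\<close> as the free \<open>R\<close>-module on the weighted singular \<open>n\<close>-simplices, that is,
  finitely supported \<open>R\<close>-valued functions; \<open>R = \<int>\<close> gives the free abelian group \<open>\<W>\<^sub>n(X, \<lambda>)\<close> itself.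
\<close>

definition wchains ::
  "nat \<Rightarrow> 'a topology \<Rightarrow> ('a \<Rightarrow> nat) \<Rightarrow> ('a wsimplex \<Rightarrow>\<^sub>0 'r::comm_ring_1) set" where
  "wchains n X lam = {c. Poly_Mapping.keys c \<subseteq> Collect (weighted_simplex n X lam)}"

text \<open>
  All natural number quotients \<open>div\<close> of weights, here and in the products, are exact on
  weighted simplices, since \<open>\<xi>\<close> is descending.
\<close>

definition wboundary ::
  "nat \<Rightarrow> ('a wsimplex \<Rightarrow>\<^sub>0 'r::comm_ring_1) \<Rightarrow> ('a wsimplex \<Rightarrow>\<^sub>0 'r)" where
  "wboundary n c =
     (if n = 0 then 0 else
        \<Sum>s\<in>Poly_Mapping.keys c. \<Sum>j\<le>n.
          Poly_Mapping.single (opposite_face n j s)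
            ((-1) ^ j * of_nat (snd s ({..n} - {j}) div snd s {..n}) * Poly_Mapping.lookup c s))"

definition wcycle_group ::
  "nat \<Rightarrow> 'a topology \<Rightarrow> ('a \<Rightarrow> nat) \<Rightarrow> ('a wsimplex \<Rightarrow>\<^sub>0 'r::comm_ring_1) monoid" where
  "wcycle_group n X lam =
     \<lparr>carrier = {c \<in> wchains n X lam. wboundary n c = 0}, monoid.mult = (+), one = 0\<rparr>"

definition wboundaries ::
  "nat \<Rightarrow> 'a topology \<Rightarrow> ('a \<Rightarrow> nat) \<Rightarrow> ('a wsimplex \<Rightarrow>\<^sub>0 'r::comm_ring_1) set" where
  "wboundaries n X lam = wboundary (Suc n) ` wchains (Suc n) X lam"

definition whomology_group ::
  "nat \<Rightarrow> 'a topology \<Rightarrow> ('a \<Rightarrow> nat) \<Rightarrow> ('a wsimplex \<Rightarrow>\<^sub>0 'r::comm_ring_1) set monoid" where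
  "whomology_group n X lam = wcycle_group n X lam Mod wboundaries n X lam"

definition whomology_class ::
  "nat \<Rightarrow> 'a topology \<Rightarrow> ('a \<Rightarrow> nat) \<Rightarrow> ('a wsimplex \<Rightarrow>\<^sub>0 'r::comm_ring_1) \<Rightarrow> ('a wsimplex \<Rightarrow>\<^sub>0 'r) set"
  where
  "whomology_class n X lam z = wboundaries n X lam #>\<^bsub>wcycle_group n X lam\<^esub> z"


section \<open>Weighted singular cohomology\<close>

text \<open>\<open>Hom(\<W>\<^sub>p(X, \<lambda>), R)\<close>; extensionality makes a homomorphism determined by its values on \<open>\<W>\<^sub>p(X, \<lambda>)\<close>.\<close>

type_synonym ('a, 'r) wcochain = "('a wsimplex \<Rightarrow>\<^sub>0 int) \<Rightarrow> 'r"

definition wcochains ::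
  "nat \<Rightarrow> 'a topology \<Rightarrow> ('a \<Rightarrow> nat) \<Rightarrow> ('a, 'r::comm_ring_1) wcochain set" where
  "wcochains p X lam =
     {\<phi> \<in> extensional (wchains p X lam).
        \<forall>c\<in>wchains p X lam. \<forall>d\<in>wchains p X lam. \<phi> (c + d) = \<phi> c + \<phi> d}"

definition wcoboundary ::
  "nat \<Rightarrow> 'a topology \<Rightarrow> ('a \<Rightarrow> nat) \<Rightarrow> ('a, 'r::comm_ring_1) wcochain \<Rightarrow> ('a, 'r) wcochain" where
  "wcoboundary p X lam \<phi> = (\<lambda>c\<in>wchains (Suc p) X lam. \<phi> (wboundary (Suc p) c))"

definition wcocycle_group ::
  "nat \<Rightarrow> 'a topology \<Rightarrow> ('a \<Rightarrow> nat) \<Rightarrow> ('a, 'r::comm_ring_1) wcochain monoid" where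
  "wcocycle_group p X lam =
     \<lparr>carrier = {\<phi> \<in> wcochains p X lam. wcoboundary p X lam \<phi> = (\<lambda>c\<in>wchains (Suc p) X lam. 0)},
      monoid.mult = (\<lambda>\<phi> \<psi>. \<lambda>c\<in>wchains p X lam. \<phi> c + \<psi> c),
      one = (\<lambda>c\<in>wchains p X lam. 0)\<rparr>"

definition wcoboundaries ::
  "nat \<Rightarrow> 'a topology \<Rightarrow> ('a \<Rightarrow> nat) \<Rightarrow> ('a, 'r::comm_ring_1) wcochain set" where
  "wcoboundaries p X lam =
     (case p of 0 \<Rightarrow> {\<lambda>c\<in>wchains 0 X lam. 0}
      | Suc k \<Rightarrow> wcoboundary k X lam ` wcochains k X lam)"

definition wcohomology_group ::
  "nat \<Rightarrow> 'a topology \<Rightarrow> ('a \<Rightarrow> nat) \<Rightarrow> ('a, 'r::comm_ring_1) wcochain set monoid" where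
  "wcohomology_group p X lam = wcocycle_group p X lam Mod wcoboundaries p X lam"

definition wcohomology_class ::
  "nat \<Rightarrow> 'a topology \<Rightarrow> ('a \<Rightarrow> nat) \<Rightarrow> ('a, 'r::comm_ring_1) wcochain \<Rightarrow> ('a, 'r) wcochain set"
  where
  "wcohomology_class p X lam \<phi> = wcoboundaries p X lam #>\<^bsub>wcocycle_group p X lam\<^esub> \<phi>"


section \<open>Weighted cup and cap products\<close>

definition wcup ::
  "nat \<Rightarrow> nat \<Rightarrow> 'a topology \<Rightarrow> ('a \<Rightarrow> nat) \<Rightarrow>
     ('a, 'r::comm_ring_1) wcochain \<Rightarrow> ('a, 'r) wcochain \<Rightarrow> ('a, 'r) wcochain" where
  "wcup p q X lam \<phi> \<psi> =
     (\<lambda>c\<in>wchains (p + q) X lam.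
        \<Sum>s\<in>Poly_Mapping.keys c.
          of_int (Poly_Mapping.lookup c s) *
          (of_nat (snd s {..p} * snd s {p..p + q} div snd s {..p + q}) *
             \<phi> (frag_of (front_face p s)) * \<psi> (frag_of (back_face (p + q) p s))))"

text \<open>Only meaningful for \<open>p \<le> n\<close>.\<close>

definition wcap ::
  "nat \<Rightarrow> nat \<Rightarrow> ('a wsimplex \<Rightarrow>\<^sub>0 'r::comm_ring_1) \<Rightarrow> ('a, 'r) wcochain \<Rightarrow> ('a wsimplex \<Rightarrow>\<^sub>0 'r)" where
  "wcap n p c \<phi> =
     (\<Sum>s\<in>Poly_Mapping.keys c.
        Poly_Mapping.single (back_face n p s)
          (Poly_Mapping.lookup c s *
           (of_nat (snd s {..p} * snd s {p..n} div snd s {..n}) * \<phi> (frag_of (front_face p s)))))"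

text \<open>
  The induced products on classes: the class of the product of any representatives. As this does
  not depend on the representatives, each union is over copies of a single class.
\<close>

definition wcohomology_cup ::
  "nat \<Rightarrow> nat \<Rightarrow> 'a topology \<Rightarrow> ('a \<Rightarrow> nat) \<Rightarrow>
     ('a, 'r::comm_ring_1) wcochain set \<Rightarrow> ('a, 'r) wcochain set \<Rightarrow> ('a, 'r) wcochain set" where
  "wcohomology_cup p q X lam F G =
     (\<Union>\<phi>\<in>F. \<Union>\<psi>\<in>G. wcohomology_class (p + q) X lam (wcup p q X lam \<phi> \<psi>))"

definition whomology_cap ::
  "nat \<Rightarrow> nat \<Rightarrow> 'a topology \<Rightarrow> ('a \<Rightarrow> nat) \<Rightarrow>
     ('a wsimplex \<Rightarrow>\<^sub>0 'r::comm_ring_1) set \<Rightarrow> ('a, 'r) wcochain set \<Rightarrow> ('a wsimplex \<Rightarrow>\<^sub>0 'r) set"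
  where
  "whomology_cap n p X lam A F =
     (\<Union>c\<in>A. \<Union>\<phi>\<in>F. whomology_class (n - p) X lam (wcap n p c \<phi>))"

end

theory Submission
  imports Defs
begin

text \<open>
  The identity already holds for chains and cochains: on a simplex with weight \<open>\<xi>\<close>, both sides
  evaluate \<open>\<phi>\<close> and \<open>\<psi>\<close> on the same faces, and both coefficients equal
  \<open>\<xi>([v\<^sub>0,\<dots>,v\<^sub>p]) \<xi>([v\<^sub>p,\<dots>,v\<^bsub>p+q\<^esub>]) \<xi>([v\<^bsub>p+q\<^esub>,\<dots>,v\<^sub>n]) / \<xi>([v\<^sub>0,\<dots>,v\<^sub>n])\<close> since the inner weight
  cancels. The Leibniz rule shows that changing a representative of a class changes the cap product
  by a boundary only.
\<close>

section \<open>Faces of weighted simplices\<close>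

text \<open>The inner weight has to be cancelled among natural numbers, where divisibility makes the
  quotients exact: in the coefficient ring a weight may be zero or a zero divisor, so nothing can be
  divided once the coefficients have been mapped there. The products on classes are unions over all
  representatives, so the claim is an equality of unions. As the identity holds for all weighted
  chains \<open>c\<close> and all \<phi>, \<psi>, only the intermediate class has to be controlled:
  on the left that of \<open>c\<close> capped with \<phi>, where a boundary is capped with the
  cocycle \<psi>; on the right that of the cup product, where the cycle \<open>c\<close> is capped
  with a coboundary. That all elements of the given classes are again cycles and cocycles rests on
  the vanishing of the double boundary. Every identity between faces is an identity between maps of
  vertex indices.\<close>

lemma weight_function_std:
  assumes "x \<in> standard_simplex n"
  shows "weight_function (std_faces n) std_rel_interior \<xi> x = \<xi> {i. x i \<noteq> 0}"
proof -
  have *: "(\<Sum>i\<le>n. x i) = 1" "\<And>i. 0 \<le> x i" "\<And>i. n < i \<Longrightarrow> x i = 0"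
    using assms by (auto simp: standard_simplex_def)
  have pos: "\<forall>i. x i \<noteq> 0 \<longrightarrow> 0 < x i"
    using *(2) by (metis order_le_less)
  have sum: "(\<Sum>i | x i \<noteq> 0. x i) = (\<Sum>i\<le>n. x i)"
    by (rule sum.mono_neutral_left) (use *(3) in \<open>auto intro: leI\<close>)
  have "{i. x i \<noteq> 0} \<noteq> {}"
    using *(1) by (metis (mono_tags) empty_Collect_eq sum.neutral zero_neq_one)
  moreover have "{i. x i \<noteq> 0} \<subseteq> {..n}"
    using *(3) by (auto intro: leI)
  ultimately have supp: "{i. x i \<noteq> 0} \<in> std_faces n"
    unfolding std_faces_def by blast
  have ri: "x \<in> std_rel_interior {i. x i \<noteq> 0}"
    unfolding std_rel_interior_def mem_Collect_eq using pos sum[unfolded *(1)] by blast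
  \<comment> \<open>Positivity on the face and vanishing off it leave the support as the only
    possible carrier.\<close>
  have "\<sigma> = {i. x i \<noteq> 0}" if \<sigma>: "x \<in> std_rel_interior \<sigma>" for \<sigma>
  proof -
    have "\<forall>i\<in>\<sigma>. 0 < x i" "\<forall>i. i \<notin> \<sigma> \<longrightarrow> x i = 0"
      using \<sigma> unfolding std_rel_interior_def by blast+
    then have "i \<in> \<sigma> \<longleftrightarrow> x i \<noteq> 0" for i
      by (metis less_irrefl)
    then show ?thesis
      by blast
  qed
  then have "(THE \<sigma>. \<sigma> \<in> std_faces n \<and> x \<in> std_rel_interior \<sigma>) = {i. x i \<noteq> 0}"
    using supp ri by - (rule the_equality, blast+)
  then show ?thesis
    by (simp add: weight_function_def)
qed

section \<open>Affine maps of standard simplices induced by maps of vertices\<close>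

definition vertex_map :: "nat \<Rightarrow> (nat \<Rightarrow> nat) \<Rightarrow> (nat \<Rightarrow> real) \<Rightarrow> nat \<Rightarrow> real" where
  "vertex_map m g = oriented_simplex m (\<lambda>j i. if i = g j then 1 else 0)"

lemma vertex_map:
  assumes "x \<in> standard_simplex m"
  shows "vertex_map m g x = (\<lambda>i. \<Sum>j\<le>m. if i = g j then x j else 0)"
  using assms unfolding vertex_map_def oriented_simplex_def
  by (auto intro!: ext sum.cong)

lemma vertex_map_in_standard_simplex:
  assumes x: "x \<in> standard_simplex m" and g: "g ` {..m} \<subseteq> {..n}"
  shows "vertex_map m g x \<in> standard_simplex n"
proof -
  have *: "(\<Sum>i\<le>m. x i) = 1" "\<And>i. 0 \<le> x i"
    using assms by (auto simp: standard_simplex_def)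
  have "(\<Sum>j\<le>m. if i = g j then x j else 0) \<le> 1" for i
    unfolding *(1)[symmetric] by (rule sum_mono) (simp add: *)
  moreover have "(\<Sum>i\<le>n. \<Sum>j\<le>m. if i = g j then x j else 0) = 1"
    using g by (subst sum.swap) (auto simp: * image_subset_iff)
  moreover have "(\<Sum>j\<le>m. if i = g j then x j else 0) = 0" if "n < i" for i
    using g that by (auto intro!: sum.neutral)
  ultimately show ?thesis
    by (auto simp: vertex_map[OF x] standard_simplex_def * intro!: sum_nonneg)
qed

text \<open>Coordinates are nonnegative, so those collected at one vertex cannot cancel. Hence
  carriers go to carriers, which transfers the condition on \<open>lam\<close> from a simplex to its
  faces.\<close>

lemma support_vertex_map:
  assumes "x \<in> standard_simplex m"
  shows "{i. vertex_map m g x i \<noteq> 0} = g ` {j. x j \<noteq> 0}"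
proof -
  have *: "\<And>i. 0 \<le> x i" "\<And>i. m < i \<Longrightarrow> x i = 0"
    using assms by (auto simp: standard_simplex_def)
  have "(\<Sum>j\<le>m. if i = g j then x j else 0) = 0 \<longleftrightarrow> (\<forall>j\<le>m. i = g j \<longrightarrow> x j = 0)" for i
    by (subst sum_nonneg_eq_0_iff) (auto simp: *)
  moreover have "j \<le> m" if "x j \<noteq> 0" for j
    using that *(2) leI by blast
  ultimately show ?thesis
    by (auto simp: vertex_map[OF assms])
qed

lemma vertex_map_vertex_map:
  assumes x: "x \<in> standard_simplex m" and g: "g ` {..m} \<subseteq> {..k}"
  shows "vertex_map k h (vertex_map m g x) = vertex_map m (h \<circ> g) x"
proof
  fix i
  have "vertex_map k h (vertex_map m g x) i =
          (\<Sum>j\<le>k. if i = h j then (\<Sum>l\<le>m. if j = g l then x l else 0) else 0)"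
    by (simp only: vertex_map[OF vertex_map_in_standard_simplex[OF x g]]) (simp only: vertex_map[OF x])
  also have "\<dots> = (\<Sum>j\<le>k. \<Sum>l\<le>m. if j = g l then if i = h j then x l else 0 else 0)"
    by (auto intro!: sum.cong sum.neutral)
  also have "\<dots> = (\<Sum>l\<le>m. if i = h (g l) then x l else 0)"
    using g by (subst sum.swap) (auto intro!: sum.cong)
  finally show "vertex_map k h (vertex_map m g x) i = vertex_map m (h \<circ> g) x i"
    by (simp add: vertex_map[OF x])
qed

lemma wface_eq:
  "wface m g s = (\<lambda>x\<in>standard_simplex m. fst s (vertex_map m g x),
                  \<lambda>S\<in>std_faces m. snd s (g ` S))"
  by (simp add: wface_def simplex_map_def vertex_map_def comp_def)

lemma snd_wface:
  assumes "S \<noteq> {}" "S \<subseteq> {..m}"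
  shows "snd (wface m g s) S = snd s (g ` S)"
  using assms by (simp add: wface_def std_faces_def)

lemma wface_cong:
  assumes "\<And>i. i \<le> m \<Longrightarrow> g i = h i"
  shows "wface m g s = wface m h s"
proof -
  have "g ` S = h ` S" if "S \<in> std_faces m" for S
    using that assms by (auto simp: std_faces_def intro!: image_cong)
  moreover have "vertex_map m g = vertex_map m h"
    using assms by (simp add: vertex_map_def oriented_simplex_eq)
  ultimately show ?thesis
    by (simp add: wface_eq cong: restrict_cong)
qed

text \<open>Affine extension is functorial. The bound on \<open>g\<close> keeps points and faces
  inside the domain on which the inner \<open>wface\<close>, being extensional, has meaningful
  values.\<close>

lemma wface_wface:
  assumes "g ` {..m} \<subseteq> {..k}"
  shows "wface m g (wface k h s) = wface m (h \<circ> g) s"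
proof -
  have "g ` S \<in> std_faces k" if "S \<in> std_faces m" for S
    using that assms by (auto simp: std_faces_def)
  then show ?thesis
    using assms unfolding wface_eq
    by (auto simp: vertex_map_in_standard_simplex vertex_map_vertex_map image_comp
        intro!: restrict_ext)
qed

lemma wface_wface_eq:
  assumes "\<And>i. i \<le> m \<Longrightarrow> g i \<le> k" "\<And>i. i \<le> m \<Longrightarrow> h (g i) = f i"
  shows "wface m g (wface k h s) = wface m f s"
  using assms by (subst wface_wface) (auto intro!: wface_cong)

text \<open>This turns a simplicial identity into index arithmetic on \<open>{..m}\<close>; the
  composite index maps need not agree elsewhere.\<close>

lemma wface_wface_cong:
  assumes "\<And>i. i \<le> m \<Longrightarrow> g i \<le> k" "\<And>i. i \<le> m \<Longrightarrow> g' i \<le> k'"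
    and "\<And>i. i \<le> m \<Longrightarrow> h (g i) = h' (g' i)"
  shows "wface m g (wface k h s) = wface m g' (wface k' h' s)"
  using assms by (simp add: wface_wface_eq[where f = "\<lambda>i. h' (g' i)"])

section \<open>Restriction of weights to faces\<close>

lemma weighted_simplex_dvd:
  assumes "weighted_simplex n X lam s" "S \<noteq> {}" "S \<subseteq> T" "T \<subseteq> {..n}"
  shows "snd s T dvd snd s S"
proof -
  have "S \<in> std_faces n" "T \<in> std_faces n"
    using assms by (auto simp: std_faces_def)
  then show ?thesis
    using assms by (auto simp: weighted_simplex_def descending_weight_def)
qed

lemma weighted_simplex_pos:
  assumes "weighted_simplex n X lam s" "S \<noteq> {}" "S \<subseteq> {..n}"
  shows "0 < snd s S"
  using assms by (auto simp: weighted_simplex_def descending_weight_def std_faces_def)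

text \<open>The ordering of the image face is pulled back along the inverse of \<open>g\<close>.
  Injectivity preserves distinctness, and the head of the pulled-back list still carries the weight
  of the face.\<close>

lemma divisible_weight_image:
  assumes \<xi>: "divisible_weight (std_faces n) \<xi>"
    and g: "inj_on g {..m}" "g ` {..m} \<subseteq> {..n}"
  shows "divisible_weight (std_faces m) (\<lambda>S\<in>std_faces m. \<xi> (g ` S))"
  unfolding divisible_weight_def
proof
  fix \<sigma> assume \<sigma>: "\<sigma> \<in> std_faces m"
  then have "g ` \<sigma> \<in> std_faces n"
    using g by (auto simp: std_faces_def)
  then obtain ws where ws: "distinct ws" "set ws = g ` \<sigma>"
      "sorted_wrt (\<lambda>v w. \<xi> {v} dvd \<xi> {w}) ws" "\<xi> (g ` \<sigma>) = \<xi> {hd ws}"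
    using \<xi> unfolding divisible_weight_def by blast
  have \<sigma>m: "\<sigma> \<subseteq> {..m}" "\<sigma> \<noteq> {}"
    using \<sigma> by (auto simp: std_faces_def)
  then have inj: "inj_on g \<sigma>"
    using g(1) inj_on_subset by blast
  define vs where "vs = map (the_inv_into \<sigma> g) ws"
  have map: "map g vs = ws"
    unfolding vs_def using inj ws(2)
    by (auto intro!: map_idI simp: f_the_inv_into_f)
  have set: "set vs = \<sigma>"
    using inj by (auto simp: vs_def ws(2) the_inv_into_f_f image_image)
  have "distinct vs"
    using ws(1) map distinct_map by blast
  moreover have "sorted_wrt (\<lambda>v w. \<xi> {g v} dvd \<xi> {g w}) vs"
    using ws(3) unfolding map[symmetric] by (simp add: sorted_wrt_map)
  moreover have face: "{v} \<in> std_faces m" if "v \<in> \<sigma>" for v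
    using that \<sigma>m by (auto simp: std_faces_def)
  moreover have "vs \<noteq> []"
    using set \<sigma>m by auto
  moreover have "hd ws = g (hd vs)" 
    using \<open>vs \<noteq> []\<close> map hd_map by blast
  moreover have "hd vs \<in> \<sigma>"
    using set \<open>vs \<noteq> []\<close> hd_in_set by blast
  ultimately show "\<exists>vs. distinct vs \<and> set vs = \<sigma> \<and>
      sorted_wrt (\<lambda>v w. (\<lambda>S\<in>std_faces m. \<xi> (g ` S)) {v} dvd (\<lambda>S\<in>std_faces m. \<xi> (g ` S)) {w}) vs \<and>
      (\<lambda>S\<in>std_faces m. \<xi> (g ` S)) \<sigma> = (\<lambda>S\<in>std_faces m. \<xi> (g ` S)) {hd vs}"
    using set \<sigma> ws(4) by (intro exI[of _ vs]) (auto elim!: sorted_wrt_mono_rel[rotated])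
qed

lemma weighted_simplex_wface:
  assumes s: "weighted_simplex n X lam s"
    and g: "inj_on g {..m}" "g ` {..m} \<subseteq> {..n}"
  shows "weighted_simplex m X lam (wface m g s)"
proof -
  obtain \<theta> \<xi> where s_eq: "s = (\<theta>, \<xi>)"
    by (cases s)
  have \<theta>: "singular_simplex n X \<theta>" and \<xi>: "descending_weight (std_faces n) \<xi>"
    and div: "divisible_weight (std_faces n) \<xi>"
    and dvd: "\<And>x. x \<in> standard_simplex n \<Longrightarrow>
      weight_function (std_faces n) std_rel_interior \<xi> x dvd lam (\<theta> x)"
    using s by (auto simp: weighted_simplex_def s_eq)
  have face: "g ` S \<in> std_faces n" if "S \<in> std_faces m" for S
    using that g by (auto simp: std_faces_def)
  have "simplicial_simplex m (standard_simplex n) (vertex_map m g)"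
    using vertex_map_in_standard_simplex[OF _ g(2)]
    unfolding vertex_map_def simplicial_simplex_oriented_simplex
    by (auto simp: oriented_simplex_def)
  then have "singular_simplex m X (simplex_map m \<theta> (vertex_map m g))"
    using \<theta> simplicial_imp_singular_simplex singular_simplex_simplex_map
    unfolding singular_simplex_def[of n] by blast
  moreover have "weight_function (std_faces m) std_rel_interior (\<lambda>S\<in>std_faces m. \<xi> (g ` S)) x
      dvd lam (\<theta> (vertex_map m g x))" if x: "x \<in> standard_simplex m" for x
  proof -
    have "(\<Sum>i\<le>m. x i) \<noteq> 0"
      using x by (auto simp: standard_simplex_def)
    then obtain i where "x i \<noteq> 0"
      by (metis sum.neutral)
    moreover have "{i. x i \<noteq> 0} \<subseteq> {..m}"
      using x unfolding standard_simplex_def by (auto intro: leI)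
    ultimately have "{i. x i \<noteq> 0} \<in> std_faces m"
      by (auto simp: std_faces_def)
    then show ?thesis
      using dvd[OF vertex_map_in_standard_simplex[OF x g(2)]]
      by (simp add: weight_function_std x vertex_map_in_standard_simplex[OF x g(2)]
          support_vertex_map)
  qed
  moreover have "descending_weight (std_faces m) (\<lambda>S\<in>std_faces m. \<xi> (g ` S))"
    using \<xi> face by (simp add: descending_weight_def image_mono)
  ultimately show ?thesis
    using divisible_weight_image[OF div g]
    by (simp add: weighted_simplex_def wface_def s_eq vertex_map_def simplex_map_def)
qed

lemma weighted_simplex_opposite_face:
  assumes "weighted_simplex (Suc n) X lam s" "j \<le> Suc n"
  shows "weighted_simplex n X lam (opposite_face (Suc n) j s)"
  using assms unfolding opposite_face_def
  by (auto intro!: weighted_simplex_wface inj_onI split: if_splits)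

lemma weighted_simplex_front_face:
  assumes "weighted_simplex n X lam s" "p \<le> n"
  shows "weighted_simplex p X lam (front_face p s)"
  using assms unfolding front_face_def
  by (auto intro!: weighted_simplex_wface inj_onI)

lemma weighted_simplex_back_face:
  assumes "weighted_simplex n X lam s" "p \<le> n"
  shows "weighted_simplex (n - p) X lam (back_face n p s)"
  using assms unfolding back_face_def
  by (auto intro!: weighted_simplex_wface inj_onI)

text \<open>Describing the image by membership tests lets later set equalities be decided pointwise.
  The truncated \<open>k - 1\<close> is guarded by \<open>j < k\<close>, so it is a true
  predecessor.\<close>

lemma skip_image:
  "(\<lambda>i. if i < j then i else Suc i) ` S = {k. k < j \<and> k \<in> S \<or> j < k \<and> k - 1 \<in> S}"
  (is "?f ` S = _")
proof (intro Set.set_eqI iffI)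
  fix k assume "k \<in> {k. k < j \<and> k \<in> S \<or> j < k \<and> k - 1 \<in> S}"
  then consider "k < j" "k \<in> S" | "j < k" "k - 1 \<in> S"
    by blast
  then show "k \<in> ?f ` S"
  proof cases
    case 1
    then show ?thesis
      by (intro image_eqI[of _ _ k]) auto
  next
    case 2
    then show ?thesis
      by (intro image_eqI[of _ _ "k - 1"]) auto
  qed
qed (auto split: if_splits)

lemma snd_opposite_face:
  assumes "S \<noteq> {}" "S \<subseteq> {..n}"
  shows "snd (opposite_face (Suc n) j s) S = snd s {k. k < j \<and> k \<in> S \<or> j < k \<and> k - 1 \<in> S}"
  \<comment> \<open>Without the deletion, \<open>if_image_distrib\<close> could split the image
    before \<open>skip_image\<close> matches it.\<close>
  using assms unfolding opposite_face_def by (simp add: snd_wface skip_image del: if_image_distrib)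

lemma snd_front_face:
  assumes "S \<noteq> {}" "S \<subseteq> {..p}"
  shows "snd (front_face p s) S = snd s S"
  using assms unfolding front_face_def by (simp add: snd_wface)

lemma snd_back_face:
  assumes "S \<noteq> {}" "S \<subseteq> {..n - p}"
  shows "snd (back_face n p s) S = snd s ((+) p ` S)"
  using assms unfolding back_face_def by (simp add: snd_wface)

section \<open>Simplicial identities for opposite, front and back faces\<close>

lemmas face_simps =
  opposite_face_def front_face_def back_face_def
  diff_Suc_1 diff_Suc_Suc diff_diff_left add_diff_cancel_left'

lemma opposite_face_opposite_face:
  assumes "i \<le> j" "j \<le> Suc n"
  shows "opposite_face (Suc n) i (opposite_face (Suc (Suc n)) (Suc j) s) =
         opposite_face (Suc n) j (opposite_face (Suc (Suc n)) i s)"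
  unfolding face_simps using assms by (intro wface_wface_cong) auto

text \<open>Deleting a vertex at or before position \<open>p\<close> moves vertex
  \<open>Suc p\<close> into position \<open>p\<close>; deleting a later one leaves position
  \<open>p\<close> unchanged. This is the reason for the case distinction in the identities that
  follow.\<close>

lemma back_opposite_face_le:
  assumes "j \<le> p" "p \<le> n"
  shows "back_face n p (opposite_face (Suc n) j s) = back_face (Suc n) (Suc p) s"
  unfolding face_simps using assms by (intro wface_wface_eq) auto

lemma back_opposite_face_gt:
  assumes "p + i \<le> n"
  shows "back_face n p (opposite_face (Suc n) (p + Suc i) s) =
         opposite_face (Suc (n - p)) (Suc i) (back_face (Suc n) p s)"
  unfolding face_simps using assms by (intro wface_wface_cong) auto

lemma front_opposite_face_le:
  assumes "j \<le> p" "p \<le> n"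
  shows "front_face p (opposite_face (Suc n) j s) = opposite_face (Suc p) j (front_face (Suc p) s)"
  unfolding face_simps using assms by (intro wface_wface_cong) auto

lemma front_opposite_face_gt:
  assumes "p < j" "p \<le> n"
  shows "front_face p (opposite_face (Suc n) j s) = front_face p s"
  unfolding face_simps using assms by (intro wface_wface_eq) auto

text \<open>With \<open>opposite_face_last_front_face\<close> this covers the two deletions at the
  junction of front and back face. They yield the same pair of faces and cancel in the Leibniz
  rule.\<close>

lemma opposite_face_0_back_face:
  assumes "p \<le> n"
  shows "opposite_face (Suc (n - p)) 0 (back_face (Suc n) p s) = back_face (Suc n) (Suc p) s"
  unfolding face_simps using assms by (intro wface_wface_eq) auto

lemma opposite_face_last_front_face:
  "opposite_face (Suc p) (Suc p) (front_face (Suc p) s) = front_face p s"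
  unfolding face_simps by (intro wface_wface_eq) auto

lemma back_face_back_face:
  assumes "p + q \<le> n"
  shows "back_face (n - p) q (back_face n p s) = back_face n (p + q) s"
proof -
  have "n - p - q = n - (p + q)"
    by simp
  then show ?thesis
    unfolding face_simps using assms by (intro wface_wface_eq) auto
qed

lemma front_face_back_face:
  assumes "p + q \<le> n"
  shows "front_face q (back_face n p s) = back_face (p + q) p (front_face (p + q) s)"
  unfolding face_simps using assms by (intro wface_wface_cong) auto

lemma front_face_front_face:
  assumes "p \<le> q"
  shows "front_face p (front_face q s) = front_face p s"
  unfolding face_simps using assms by (intro wface_wface_eq) auto

section \<open>Chains and cochains\<close>

lemma wchains_zero [simp]: "0 \<in> wchains n X lam"
  by (simp add: wchains_def)

lemma wchains_add: "c \<in> wchains n X lam \<Longrightarrow> d \<in> wchains n X lam \<Longrightarrow> c + d \<in> wchains n X lam"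
  using keys_add[of c d] by (auto simp: wchains_def)

lemma wchains_uminus: "c \<in> wchains n X lam \<Longrightarrow> - c \<in> wchains n X lam"
  by (auto simp: wchains_def in_keys_iff)

lemma wchains_sum:
  "(\<And>i. i \<in> I \<Longrightarrow> f i \<in> wchains n X lam) \<Longrightarrow> (\<Sum>i\<in>I. f i) \<in> wchains n X lam"
  by (induction I rule: infinite_finite_induct) (auto intro: wchains_add)

lemma wchains_single: "weighted_simplex n X lam s \<Longrightarrow> Poly_Mapping.single s a \<in> wchains n X lam"
  by (simp add: wchains_def)

lemma poly_mapping_sum_single:
  "(\<Sum>s\<in>Poly_Mapping.keys c. Poly_Mapping.single s (Poly_Mapping.lookup c s)) = c"
proof (rule poly_mapping_eqI)
  fix t
  have "(\<Sum>s\<in>Poly_Mapping.keys c. Poly_Mapping.lookup (Poly_Mapping.single s (Poly_Mapping.lookup c s)) t) =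
          (\<Sum>s\<in>Poly_Mapping.keys c. if t = s then Poly_Mapping.lookup c t else 0)"
    by (intro sum.cong) (auto simp: lookup_single)
  then show "Poly_Mapping.lookup
      (\<Sum>s\<in>Poly_Mapping.keys c. Poly_Mapping.single s (Poly_Mapping.lookup c s)) t = Poly_Mapping.lookup c t"
    by (simp add: lookup_sum in_keys_iff)
qed

text \<open>Finite support lets identities additive in the chain be checked on one simplex with an
  arbitrary coefficient.\<close>

lemma wchains_induct [consumes 1, case_names zero single add]:
  assumes c: "c \<in> wchains n X lam"
    and zero: "P 0"
    and single: "\<And>s a. weighted_simplex n X lam s \<Longrightarrow> P (Poly_Mapping.single s a)"
    and add: "\<And>c d. P c \<Longrightarrow> P d \<Longrightarrow> P (c + d)"
  shows "P c"
proof -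
  have "P (\<Sum>s\<in>S. Poly_Mapping.single s (Poly_Mapping.lookup c s))"
    if "finite S" "S \<subseteq> Poly_Mapping.keys c" for S
    using that
  proof (induction S rule: finite_induct)
    case empty
    then show ?case
      by (simp add: zero)
  next
    case (insert s S)
    then have "weighted_simplex n X lam s"
      using c by (auto simp: wchains_def)
    then show ?case
      using insert by (simp add: single add)
  qed
  from this[of "Poly_Mapping.keys c"] show ?thesis
    by (simp add: poly_mapping_sum_single)
qed

lemma wboundary_single:
  "wboundary (Suc n) (Poly_Mapping.single s a) =
     (\<Sum>j\<le>Suc n. Poly_Mapping.single (opposite_face (Suc n) j s)
        ((-1) ^ j * of_nat (snd s ({..Suc n} - {j}) div snd s {..Suc n}) * a))"
  by (cases "a = 0") (simp_all add: wboundary_def)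

lemma wboundary_zero [simp]: "wboundary n 0 = 0"
  by (simp add: wboundary_def)

text \<open>The supports of \<open>c\<close> and \<open>d\<close> may overlap or cancel. This is
  harmless because each summand is additive in the coefficient and vanishes at coefficient
  zero.\<close>

lemma wboundary_add: "wboundary n (c + d) = wboundary n c + wboundary n d"
  unfolding wboundary_def
  by (cases "n = 0")
    (auto simp: single_add distrib_left sum.distrib intro!: setsum_keys_plus_distrib)

lemma wboundary_uminus: "wboundary n (- c) = - wboundary n c"
  using wboundary_add[of n c "- c"] by (simp add: eq_neg_iff_add_eq_0 add.commute)

lemma wboundary_sum: "wboundary n (\<Sum>i\<in>I. f i) = (\<Sum>i\<in>I. wboundary n (f i))"
  by (induction I rule: infinite_finite_induct) (simp_all add: wboundary_add)

lemma wboundary_in_wchains: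
  "c \<in> wchains (Suc n) X lam \<Longrightarrow> wboundary (Suc n) c \<in> wchains n X lam"
  by (induction rule: wchains_induct)
    (auto simp: wboundary_single wboundary_add simp del: sum.atMost_Suc
      intro!: wchains_sum wchains_add wchains_single weighted_simplex_opposite_face)

section \<open>Cap products on the chain level\<close>

lemma wcap_single:
  "wcap n p (Poly_Mapping.single s a) \<phi> = Poly_Mapping.single (back_face n p s)
     (a * (of_nat (snd s {..p} * snd s {p..n} div snd s {..n}) * \<phi> (frag_of (front_face p s))))"
  by (cases "a = 0") (simp_all add: wcap_def)

lemma wcap_zero [simp]: "wcap n p 0 \<phi> = 0"
  by (simp add: wcap_def)

lemma wcap_add: "wcap n p (c + d) \<phi> = wcap n p c \<phi> + wcap n p d \<phi>"
  unfolding wcap_def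
  by (intro setsum_keys_plus_distrib) (simp_all add: single_add distrib_right)

lemma wcap_sum: "wcap n p (\<Sum>i\<in>I. f i) \<phi> = (\<Sum>i\<in>I. wcap n p (f i) \<phi>)"
  by (induction I rule: infinite_finite_induct) (simp_all add: wcap_add)

lemma wcap_in_wchains:
  "c \<in> wchains n X lam \<Longrightarrow> p \<le> n \<Longrightarrow> wcap n p c \<phi> \<in> wchains (n - p) X lam"
  by (induction rule: wchains_induct)
    (auto simp: wcap_single wcap_add intro!: wchains_add wchains_single weighted_simplex_back_face)

lemma wcap_cochain_add: "wcap n p c (\<lambda>x. \<phi> x + \<psi> x) = wcap n p c \<phi> + wcap n p c \<psi>"
  by (simp add: wcap_def distrib_left single_add sum.distrib)

lemma wcap_cochain_zero: "wcap n p c (\<lambda>x. 0) = 0"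
  by (simp add: wcap_def)

text \<open>The cap product evaluates its cochain on front faces only. The lemma allows functions
  that are not extensional, such as pointwise sums, to stand in for cochains.\<close>

lemma wcap_cochain_cong:
  assumes c: "c \<in> wchains n X lam" and "p \<le> n"
    and eq: "\<And>x. x \<in> wchains p X lam \<Longrightarrow> \<phi> x = \<psi> x"
  shows "wcap n p c \<phi> = wcap n p c \<psi>"
  unfolding wcap_def
proof (intro sum.cong refl)
  fix s assume "s \<in> Poly_Mapping.keys c"
  then have "\<phi> (frag_of (front_face p s)) = \<psi> (frag_of (front_face p s))"
    using c \<open>p \<le> n\<close> by (intro eq wchains_single weighted_simplex_front_face) (auto simp: wchains_def)
  then show "Poly_Mapping.single (back_face n p s)
      (Poly_Mapping.lookup c s *
        (of_nat (snd s {..p} * snd s {p..n} div snd s {..n}) * \<phi> (frag_of (front_face p s)))) =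
    Poly_Mapping.single (back_face n p s)
      (Poly_Mapping.lookup c s *
        (of_nat (snd s {..p} * snd s {p..n} div snd s {..n}) * \<psi> (frag_of (front_face p s))))"
    by simp
qed

section \<open>Cochains and their coboundaries\<close>

lemma wcochains_add:
  "\<phi> \<in> wcochains p X lam \<Longrightarrow> c \<in> wchains p X lam \<Longrightarrow> d \<in> wchains p X lam \<Longrightarrow> \<phi> (c + d) = \<phi> c + \<phi> d"
  by (simp add: wcochains_def)

lemma wcochains_zero: "\<phi> \<in> wcochains p X lam \<Longrightarrow> \<phi> 0 = 0"
  using wcochains_add[of \<phi> p X lam 0 0] by simp

lemma wcochains_sum:
  assumes "\<phi> \<in> wcochains p X lam" "\<And>i. i \<in> I \<Longrightarrow> f i \<in> wchains p X lam"
  shows "\<phi> (\<Sum>i\<in>I. f i) = (\<Sum>i\<in>I. \<phi> (f i))"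
  using assms(2)
  by (induction I rule: infinite_finite_induct)
    (simp_all add: wcochains_zero[OF assms(1)] wcochains_add[OF assms(1)] wchains_sum)

text \<open>A cochain is only assumed additive, so integer multiples are reached by induction
  upwards and downwards from zero.\<close>

lemma wcochains_single:
  assumes \<phi>: "\<phi> \<in> wcochains p X lam" and s: "weighted_simplex p X lam s"
  shows "\<phi> (Poly_Mapping.single s k) = of_int k * \<phi> (frag_of s)"
proof (induction k rule: int_induct[where k = 0])
  case base
  then show ?case
    by (simp add: wcochains_zero[OF \<phi>])
next
  case (step1 i)
  then show ?case
    by (simp add: single_add wcochains_add[OF \<phi>] wchains_single[OF s] distrib_right)
next
  case (step2 i)
  have "Poly_Mapping.single s i = Poly_Mapping.single s (i - 1) + frag_of s"
    by (simp flip: single_add)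
  then have "\<phi> (Poly_Mapping.single s i) = \<phi> (Poly_Mapping.single s (i - 1)) + \<phi> (frag_of s)"
    by (simp add: wcochains_add[OF \<phi>] wchains_single[OF s])
  then show ?case
    using step2 by (simp add: algebra_simps)
qed

lemma wcoboundary_frag_of:
  assumes \<phi>: "\<phi> \<in> wcochains p X lam" and s: "weighted_simplex (Suc p) X lam s"
  shows "wcoboundary p X lam \<phi> (frag_of s) =
    (\<Sum>j\<le>Suc p. (-1) ^ j * of_nat (snd s ({..Suc p} - {j}) div snd s {..Suc p}) *
       \<phi> (frag_of (opposite_face (Suc p) j s)))"
proof -
  have "wcoboundary p X lam \<phi> (frag_of s) = \<phi> (wboundary (Suc p) (frag_of s))"
    by (simp add: wcoboundary_def wchains_single[OF s])
  also have "\<dots> = (\<Sum>j\<le>Suc p. \<phi> (Poly_Mapping.single (opposite_face (Suc p) j s)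
      ((-1) ^ j * of_nat (snd s ({..Suc p} - {j}) div snd s {..Suc p}) * 1)))"
    unfolding wboundary_single
    by (rule wcochains_sum[OF \<phi>]) (auto intro!: wchains_single weighted_simplex_opposite_face[OF s])
  also have "\<dots> = (\<Sum>j\<le>Suc p. (-1) ^ j * of_nat (snd s ({..Suc p} - {j}) div snd s {..Suc p}) *
       \<phi> (frag_of (opposite_face (Suc p) j s)))"
    by (intro sum.cong refl, subst wcochains_single[OF \<phi>])
      (auto intro!: weighted_simplex_opposite_face[OF s])
  finally show ?thesis .
qed

section \<open>The boundary of a boundary and the Leibniz rule\<close>

text \<open>
  Every comparison of weight factors below is an instance of this cancellation, with \<open>C\<close> the weight
  of the whole simplex and \<open>D\<close> that of an intermediate face.
\<close>

lemma weight_quotient_mult: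
  fixes C D P :: nat
  assumes "0 < C" "0 < D" "C dvd D" "D dvd P"
  shows "(D * Q div C) * (P * R div D) = P * Q * R div C"
proof -
  obtain d k where "D = C * d" "P = D * k"
    using assms(3,4) by (elim dvdE)
  then show ?thesis
    using assms(1,2) by (simp add: mult.assoc)
qed

text \<open>The pairs \<open>(j, i)\<close> with \<open>i < j\<close> correspond to those with
  \<open>j \<le> i\<close> through \<open>(i, j - 1)\<close>, and paired terms are opposite.
  Splitting the index set, instead of showing that the sum equals its negative, avoids dividing by
  two.\<close>

lemma sum_alternating_cancel:
  fixes T :: "nat \<Rightarrow> nat \<Rightarrow> 'b::ab_group_add"
  assumes "\<And>i j. i \<le> j \<Longrightarrow> j \<le> n \<Longrightarrow> T (Suc j) i = - T i j"
  shows "(\<Sum>j\<le>Suc n. \<Sum>i\<le>n. T j i) = 0"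
proof -
  define L U where "L = {(j, i). i < j \<and> j \<le> Suc n}" and "U = {(j, i). j \<le> i \<and> i \<le> n}"
  have LU: "{..Suc n} \<times> {..n} = L \<union> U" "L \<inter> U = {}"
    by (auto simp: L_def U_def)
  then have fin: "finite L" "finite U"
    by (metis finite_Un finite_SigmaI finite_atMost)+
  have "(\<Sum>j\<le>Suc n. \<Sum>i\<le>n. T j i) = (\<Sum>(j, i)\<in>L \<union> U. T j i)"
    unfolding LU(1)[symmetric] by (rule sum.cartesian_product)
  also have "\<dots> = (\<Sum>(j, i)\<in>L. T j i) + (\<Sum>(j, i)\<in>U. T j i)"
    using fin LU(2) by (rule sum.union_disjoint)
  also have "(\<Sum>(j, i)\<in>L. T j i) = (\<Sum>(j, i)\<in>U. T (Suc i) j)"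
    unfolding L_def U_def
    by (rule sum.reindex_bij_witness[of _ "\<lambda>(j, i). (Suc i, j)" "\<lambda>(j, i). (i, j - 1)"]) auto
  also have "\<dots> = (\<Sum>(j, i)\<in>U. - T j i)"
    using assms by (intro sum.cong) (auto simp: U_def)
  finally show ?thesis
    by (simp add: case_prod_beta sum_negf)
qed

text \<open>The two weight quotients telescope to the weight of the codimension two face over that
  of the whole simplex. This factor does not depend on the order of the two deletions, so the usual
  sign cancellation applies.\<close>

lemma wboundary_wboundary_single:
  fixes a :: "'r::comm_ring_1"
  assumes s: "weighted_simplex (Suc (Suc n)) X lam s"
  shows "wboundary (Suc n) (wboundary (Suc (Suc n)) (Poly_Mapping.single s a)) = 0"
proof -
  let ?N = "{..Suc (Suc n)}"
  \<comment> \<open>\<open>skip j i\<close> is the original vertex found at position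
    \<open>i\<close> once vertex \<open>j\<close> has been removed.\<close>
  define skip :: "nat \<Rightarrow> nat \<Rightarrow> nat" where "skip = (\<lambda>j i. if i < j then i else Suc i)"
  define T where "T = (\<lambda>j i. Poly_Mapping.single (opposite_face (Suc n) i (opposite_face (Suc (Suc n)) j s))
     ((-1) ^ (j + i) * of_nat (snd s (?N - {j, skip j i}) div snd s ?N) * a))"
  have "Poly_Mapping.single (opposite_face (Suc n) i (opposite_face (Suc (Suc n)) j s))
          ((-1) ^ i * of_nat (snd (opposite_face (Suc (Suc n)) j s) ({..Suc n} - {i}) div
             snd (opposite_face (Suc (Suc n)) j s) {..Suc n}) *
           ((-1) ^ j * of_nat (snd s (?N - {j}) div snd s ?N) * a)) = T j i"
    if ij: "j \<le> Suc (Suc n)" "i \<le> Suc n" for i j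
  proof -
    have ne: "{..Suc n} - {i} \<noteq> {}"
      by (cases "i = 0") auto
    have "snd (opposite_face (Suc (Suc n)) j s) {..Suc n} = snd s (?N - {j})"
      using ij by (subst snd_opposite_face) (auto intro!: arg_cong[where f = "snd s"])
    moreover have "snd (opposite_face (Suc (Suc n)) j s) ({..Suc n} - {i}) = snd s (?N - {j, skip j i})"
      using ij ne by (subst snd_opposite_face) (auto simp: skip_def intro!: arg_cong[where f = "snd s"])
    moreover have "(snd s (?N - {j}) div snd s ?N) * (snd s (?N - {j, skip j i}) div snd s (?N - {j})) =
        snd s (?N - {j, skip j i}) div snd s ?N"
    proof -
      \<comment> \<open>At least three vertices are present and at most two are removed.
        Nonemptiness matters because the empty set is not a simplex and its weight is
        uncontrolled.\<close>
      have ne: "?N - {j, skip j i} \<noteq> {}"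
      proof -
        have "card {j, skip j i} \<le> 2"
          by (simp add: card_insert_if)
        then have "\<not> ?N \<subseteq> {j, skip j i}"
          using card_mono[of "{j, skip j i}" ?N] by auto
        then show ?thesis
          by blast
      qed
      then have "?N - {j} \<noteq> {}"
        by blast
      with ne show ?thesis
        using weight_quotient_mult[of "snd s ?N" "snd s (?N - {j})" "snd s (?N - {j, skip j i})" 1 1]
        by (simp add: weighted_simplex_pos[OF s] weighted_simplex_dvd[OF s] subset_insertI2 Diff_mono)
    qed
    then have "of_nat (snd s (?N - {j}) div snd s ?N) * of_nat (snd s (?N - {j, skip j i}) div snd s (?N - {j})) =
        (of_nat (snd s (?N - {j, skip j i}) div snd s ?N) :: 'r)"
      by (simp flip: of_nat_mult)
    ultimately show ?thesis
      unfolding T_def by (simp add: power_add mult_ac)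
  qed
  then have "wboundary (Suc n) (wboundary (Suc (Suc n)) (Poly_Mapping.single s a)) =
      (\<Sum>j\<le>Suc (Suc n). \<Sum>i\<le>Suc n. T j i)"
    unfolding wboundary_single wboundary_sum by (intro sum.cong refl) auto
  also have "\<dots> = 0"
  proof (rule sum_alternating_cancel)
    fix i j assume ij: "i \<le> j" "j \<le> Suc n"
    then have "{Suc j, skip (Suc j) i} = {i, skip i j}"
      by (auto simp: skip_def)
    then show "T (Suc j) i = - T i j"
      using ij by (simp add: T_def opposite_face_opposite_face add.commute flip: single_uminus)
  qed
  finally show ?thesis .
qed

lemma wboundary_wboundary:
  assumes "c \<in> wchains (Suc n) X lam"
  shows "wboundary n (wboundary (Suc n) c) = 0"
proof (cases n)
  case 0
  then show ?thesis
    by (simp add: wboundary_def)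
next
  case (Suc m)
  show ?thesis
    using assms unfolding Suc
    by (induction rule: wchains_induct) (simp_all add: wboundary_wboundary_single wboundary_add)
qed

section \<open>The Leibniz rule for the cap product\<close>

lemma sum_atMost_split_at:
  fixes f :: "nat \<Rightarrow> 'b::ab_group_add"
  assumes "p \<le> n"
  shows "(\<Sum>j\<le>Suc n. f j) = (\<Sum>j\<le>p. f j) + (\<Sum>i\<le>n - p. f (p + Suc i))"
proof -
  obtain m where "n = p + m"
    using assms le_Suc_ex by blast
  moreover have "(\<Sum>j\<le>Suc (p + m). f j) = (\<Sum>j\<le>p. f j) + (\<Sum>i\<le>m. f (p + Suc i))"
    by (induction m) (simp_all add: add.assoc)
  ultimately show ?thesis
    by simp
qed

lemma poly_mapping_single_sum:
  "Poly_Mapping.single s (\<Sum>i\<in>I. f i) = (\<Sum>i\<in>I. Poly_Mapping.single s (f i))"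
  by (induction I rule: infinite_finite_induct) (simp_all add: single_add)

text \<open>
  The sign of the Leibniz rule sits on the cochain, because finitely supported functions carry no
  scalar multiplication.
\<close>

lemma wboundary_wcap_single:
  fixes a :: "'r::comm_ring_1" and \<phi> :: "('a, 'r) wcochain"
  assumes s: "weighted_simplex (Suc n) X lam s" and \<phi>: "\<phi> \<in> wcochains p X lam" and pn: "p \<le> n"
  shows "wboundary (Suc (n - p)) (wcap (Suc n) p (Poly_Mapping.single s a) (\<lambda>x. (-1) ^ p * \<phi> x)) =
    wcap n p (wboundary (Suc n) (Poly_Mapping.single s a)) \<phi> -
    wcap (Suc n) (Suc p) (Poly_Mapping.single s a) (wcoboundary p X lam \<phi>)"
proof -
  define C where "C = snd s {..Suc n}"
  \<comment> \<open>\<open>E j\<close> belongs to deleting vertex \<open>j\<close> from the front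
    face ending at \<open>Suc p\<close>, and \<open>H i\<close> to deleting vertex
    \<open>p + i\<close> from the back face starting at \<open>p\<close>. The left-hand side is the
    sum of all \<open>H\<close>; on the right, the first term gives the \<open>E\<close> up to
    \<open>p\<close> and the \<open>H\<close> from 1 on, the second all \<open>E\<close>.\<close>
  define E where "E = (\<lambda>j. Poly_Mapping.single (back_face (Suc n) (Suc p) s)
     ((-1) ^ j * a * of_nat (snd s ({..Suc p} - {j}) * snd s {Suc p..Suc n} div C) *
        \<phi> (frag_of (opposite_face (Suc p) j (front_face (Suc p) s)))))"
  define H where "H = (\<lambda>i. Poly_Mapping.single (opposite_face (Suc (n - p)) i (back_face (Suc n) p s))
     ((-1) ^ (p + i) * a * of_nat (snd s {..p} * snd s ({p..Suc n} - {p + i}) div C) *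
        \<phi> (frag_of (front_face p s))))"
  have pos: "0 < snd s S" if "S \<noteq> {}" "S \<subseteq> {..Suc n}" for S
    using that weighted_simplex_pos[OF s] by blast
  have dvd: "snd s T dvd snd s S" if "S \<noteq> {}" "S \<subseteq> T" "T \<subseteq> {..Suc n}" for S T
    using that weighted_simplex_dvd[OF s] by blast
  have quot: "of_nat (snd s T * u div C) * of_nat (snd s S * v div snd s T) = (of_nat (snd s S * u * v div C) :: 'r)"
    if "S \<noteq> {}" "S \<subseteq> T" "T \<subseteq> {..Suc n}" for S T u v
  proof -
    have "T \<noteq> {}"
      using that(1,2) by blast
    then have "(snd s T * u div C) * (snd s S * v div snd s T) = snd s S * u * v div C"
      using that unfolding C_def by (intro weight_quotient_mult pos dvd) auto
    then show ?thesis
      by (simp only: of_nat_mult[symmetric])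
  qed
  have ne: "{..Suc k} - {j} \<noteq> {}" for j k :: nat
    by (cases "j = 0") auto
  have ne': "{p..Suc n} - {j} \<noteq> {}" for j
  proof -
    \<comment> \<open>The witness is an endpoint other than \<open>j\<close>; the endpoints differ
      since \<open>p \<le> n\<close>.\<close>
    have "(if j = p then Suc n else p) \<in> {p..Suc n} - {j}"
      using pn by simp
    then show ?thesis
      by blast
  qed

  have lhs: "wboundary (Suc (n - p)) (wcap (Suc n) p (Poly_Mapping.single s a) (\<lambda>x. (-1) ^ p * \<phi> x)) =
      (\<Sum>i\<le>Suc (n - p). H i)"
    unfolding wcap_single wboundary_single
  proof (intro sum.cong refl)
    fix i assume i: "i \<in> {..Suc (n - p)}"
    have b: "snd (back_face (Suc n) p s) {..Suc (n - p)} = snd s {p..Suc n}"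
      using pn by (subst snd_back_face) (auto simp: atMost_atLeast0 Suc_diff_le)
    have "(+) p ` ({..Suc (n - p)} - {i}) = {p..Suc n} - {p + i}"
      using pn by (subst image_set_diff) (auto simp: atMost_atLeast0)
    then have b': "snd (back_face (Suc n) p s) ({..Suc (n - p)} - {i}) = snd s ({p..Suc n} - {p + i})"
      using pn ne by (subst snd_back_face) (auto simp: Suc_diff_le)
    have key: "(of_nat (snd s {..p} * snd s ({p..Suc n} - {p + i}) div C) :: 'r) =
        of_nat (snd s {..p} * snd s {p..Suc n} div C) *
          of_nat (snd s ({p..Suc n} - {p + i}) div snd s {p..Suc n})"
      using quot[of "{p..Suc n} - {p + i}" "{p..Suc n}" "snd s {..p}" 1] ne' by (simp add: mult.commute)
    show "Poly_Mapping.single (opposite_face (Suc (n - p)) i (back_face (Suc n) p s))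
        ((-1) ^ i * of_nat (snd (back_face (Suc n) p s) ({..Suc (n - p)} - {i}) div
            snd (back_face (Suc n) p s) {..Suc (n - p)}) *
          (a * (of_nat (snd s {..p} * snd s {p..Suc n} div snd s {..Suc n}) *
            ((-1) ^ p * \<phi> (frag_of (front_face p s)))))) = H i"
      unfolding H_def b b' C_def[symmetric] power_add
      by (intro arg_cong[where f = "Poly_Mapping.single _"], unfold key) (simp only: mult_ac)
  qed

  \<comment> \<open>\<open>F\<close> and \<open>B\<close> stand for the weights of the front and
    back part of the \<open>j\<close>-th face. Divisibility of \<open>F\<close> alone makes the
    intermediate weight cancel, so one computation serves deletions on either side of the
    junction.\<close>
  have cap_face: "wcap n p (Poly_Mapping.single (opposite_face (Suc n) j s)
        ((-1) ^ j * of_nat (snd s ({..Suc n} - {j}) div snd s {..Suc n}) * a)) \<phi> =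
      Poly_Mapping.single (back_face n p (opposite_face (Suc n) j s))
        ((-1) ^ j * a * of_nat (F * B div C) * \<phi> (frag_of (front_face p (opposite_face (Suc n) j s))))"
    if FB: "snd (opposite_face (Suc n) j s) {..p} = F" "snd (opposite_face (Suc n) j s) {p..n} = B"
      and W: "snd (opposite_face (Suc n) j s) {..n} = snd s ({..Suc n} - {j})"
      and F: "snd s ({..Suc n} - {j}) dvd F" for j F B
  proof -
    have "0 < snd s ({..Suc n} - {j})" "C dvd snd s ({..Suc n} - {j})" "0 < C"
      unfolding C_def
      using ne[of n j] pos[of "{..Suc n} - {j}"] pos[of "{..Suc n}"] dvd[of "{..Suc n} - {j}" "{..Suc n}"]
      by blast+
    then have "(snd s ({..Suc n} - {j}) div C) * (F * B div snd s ({..Suc n} - {j})) = F * B div C"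
      using F weight_quotient_mult[of C "snd s ({..Suc n} - {j})" F 1 B] by simp
    then have key: "(of_nat (F * B div C) :: 'r) =
        of_nat (snd s ({..Suc n} - {j}) div C) * of_nat (F * B div snd s ({..Suc n} - {j}))"
      by (simp flip: of_nat_mult)
    show ?thesis
      unfolding wcap_single FB W C_def[symmetric]
      by (intro arg_cong[where f = "Poly_Mapping.single _"], unfold key) (simp only: mult_ac)
  qed

  have W: "snd (opposite_face (Suc n) j s) {..n} = snd s ({..Suc n} - {j})" if "j \<le> Suc n" for j
    using that by (subst snd_opposite_face) (auto intro!: arg_cong[where f = "snd s"])

  have rhs1: "wcap n p (wboundary (Suc n) (Poly_Mapping.single s a)) \<phi> = (\<Sum>j\<le>p. E j) + (\<Sum>i\<le>n - p. H (Suc i))"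
    unfolding wboundary_single sum_atMost_split_at[OF pn] wcap_add wcap_sum
  proof (intro arg_cong2[where f = "(+)"] sum.cong refl)
    fix j assume j: "j \<in> {..p}"
    have 1: "snd (opposite_face (Suc n) j s) {..p} = snd s ({..Suc p} - {j})"
      using j pn by (subst snd_opposite_face) (auto intro!: arg_cong[where f = "snd s"])
    have 2: "snd (opposite_face (Suc n) j s) {p..n} = snd s {Suc p..Suc n}"
      using j pn by (subst snd_opposite_face) (auto intro!: arg_cong[where f = "snd s"])
    have "snd s ({..Suc n} - {j}) dvd snd s ({..Suc p} - {j})"
      using ne pn by (intro dvd) auto
    then show "wcap n p (Poly_Mapping.single (opposite_face (Suc n) j s)
        ((-1) ^ j * of_nat (snd s ({..Suc n} - {j}) div snd s {..Suc n}) * a)) \<phi> = E j"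
      using j pn by (subst cap_face[OF 1 2 W]) (auto simp: E_def back_opposite_face_le front_opposite_face_le)
  next
    fix i assume i: "i \<in> {..n - p}"
    have 1: "snd (opposite_face (Suc n) (p + Suc i) s) {..p} = snd s {..p}"
      using i pn by (subst snd_opposite_face) (auto intro!: arg_cong[where f = "snd s"])
    have 2: "snd (opposite_face (Suc n) (p + Suc i) s) {p..n} = snd s ({p..Suc n} - {p + Suc i})"
      using i pn by (subst snd_opposite_face) (auto intro!: arg_cong[where f = "snd s"])
    have "snd s ({..Suc n} - {p + Suc i}) dvd snd s {..p}"
      using pn by (intro dvd) auto
    then show "wcap n p (Poly_Mapping.single (opposite_face (Suc n) (p + Suc i) s)
        ((-1) ^ (p + Suc i) * of_nat (snd s ({..Suc n} - {p + Suc i}) div snd s {..Suc n}) * a)) \<phi> = H (Suc i)"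
      using i pn by (subst cap_face[OF 1 2 W])
        (auto simp: H_def back_opposite_face_gt[simplified] front_opposite_face_gt)
  qed

  have rhs2: "wcap (Suc n) (Suc p) (Poly_Mapping.single s a) (wcoboundary p X lam \<phi>) = (\<Sum>j\<le>Suc p. E j)"
  proof -
    have f: "weighted_simplex (Suc p) X lam (front_face (Suc p) s)"
      using s pn by (intro weighted_simplex_front_face) auto
    have fS: "snd (front_face (Suc p) s) {..Suc p} = snd s {..Suc p}"
      by (simp add: snd_front_face)
    have fj: "snd (front_face (Suc p) s) ({..Suc p} - {j}) = snd s ({..Suc p} - {j})" for j
      using ne by (intro snd_front_face) auto
    have "a * (of_nat (snd s {..Suc p} * snd s {Suc p..Suc n} div C) *
          ((-1) ^ j * of_nat (snd s ({..Suc p} - {j}) div snd s {..Suc p}) * y)) =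
        (-1) ^ j * a * of_nat (snd s ({..Suc p} - {j}) * snd s {Suc p..Suc n} div C) * y" for j y
    proof -
      have "(of_nat (snd s ({..Suc p} - {j}) * snd s {Suc p..Suc n} div C) :: 'r) =
          of_nat (snd s {..Suc p} * snd s {Suc p..Suc n} div C) *
            of_nat (snd s ({..Suc p} - {j}) div snd s {..Suc p})"
        using quot[of "{..Suc p} - {j}" "{..Suc p}" "snd s {Suc p..Suc n}" 1] ne pn by simp
      then show ?thesis
        by (simp only: mult_ac)
    qed
    then show ?thesis
      unfolding wcap_single wcoboundary_frag_of[OF \<phi> f] fS fj C_def[symmetric] E_def
      by (simp only: sum_distrib_left poly_mapping_single_sum)
  qed

  \<comment> \<open>Both junction terms pair the front face up to \<open>p\<close> with the back
    face from \<open>Suc p\<close>; their signs are the powers of -1 with exponents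
    \<open>Suc p\<close> and \<open>p\<close>.\<close>
  have "E (Suc p) = - H 0"
  proof -
    have "{..Suc p} - {Suc p} = {..p}" "{p..Suc n} - {p} = {Suc p..Suc n}"
      by auto
    then show ?thesis
      by (simp add: E_def H_def opposite_face_last_front_face opposite_face_0_back_face[OF pn]
          flip: single_uminus)
  qed
  moreover have "(\<Sum>i\<le>Suc (n - p). H i) = H 0 + (\<Sum>i\<le>n - p. H (Suc i))"
    by (rule sum.atMost_Suc_shift)
  ultimately show ?thesis
    unfolding lhs rhs1 rhs2 by simp
qed

lemma wboundary_wcap:
  assumes c: "c \<in> wchains (Suc n) X lam" and \<phi>: "\<phi> \<in> wcochains p X lam" and pn: "p \<le> n"
  shows "wboundary (Suc (n - p)) (wcap (Suc n) p c (\<lambda>x. (-1) ^ p * \<phi> x)) =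
    wcap n p (wboundary (Suc n) c) \<phi> - wcap (Suc n) (Suc p) c (wcoboundary p X lam \<phi>)"
  using c
  by (induction rule: wchains_induct)
    (simp_all add: wboundary_wcap_single[OF _ \<phi> pn] wboundary_add wcap_add)

section \<open>The cap-cup identity on chains\<close>

lemma wcap_wcap_single:
  fixes a :: "'r::comm_ring_1" and \<phi> \<psi> :: "('a, 'r) wcochain"
  assumes s: "weighted_simplex n X lam s" and pq: "p + q \<le> n"
  shows "wcap (n - p) q (wcap n p (Poly_Mapping.single s a) \<phi>) \<psi> =
    wcap n (p + q) (Poly_Mapping.single s a) (wcup p q X lam \<phi> \<psi>)"
proof -
  have f: "weighted_simplex (p + q) X lam (front_face (p + q) s)"
    using s pq by (rule weighted_simplex_front_face)
  have pos: "0 < snd s S" if "S \<noteq> {}" "S \<subseteq> {..n}" for S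
    using that weighted_simplex_pos[OF s] by blast
  have dvd: "snd s T dvd snd s S" if "S \<noteq> {}" "S \<subseteq> T" "T \<subseteq> {..n}" for S T
    using that weighted_simplex_dvd[OF s] by blast
  have b: "snd (back_face n p s) {..q} = snd s {p..p + q}"
      "snd (back_face n p s) {q..n - p} = snd s {p + q..n}"
      "snd (back_face n p s) {..n - p} = snd s {p..n}"
    using pq by (simp_all add: snd_back_face atMost_atLeast0 add.commute)
  have cup: "wcup p q X lam \<phi> \<psi> (frag_of (front_face (p + q) s)) =
      of_nat (snd s {..p} * snd s {p..p + q} div snd s {..p + q}) *
        \<phi> (frag_of (front_face p s)) * \<psi> (frag_of (back_face (p + q) p (front_face (p + q) s)))"
    using wchains_single[OF f, of "1::int"] by (simp add: wcup_def snd_front_face front_face_front_face)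
  \<comment> \<open>The intermediate face is \<open>{p..n}\<close> for the iterated cap product,
    with weight dividing that of \<open>{p..p + q}\<close>, and \<open>{..p + q}\<close> for the cup
    product, with weight dividing that of \<open>{..p}\<close>.\<close>
  have "(snd s {p..n} * snd s {..p} div snd s {..n}) *
          (snd s {p..p + q} * snd s {p + q..n} div snd s {p..n}) =
        snd s {p..p + q} * snd s {..p} * snd s {p + q..n} div snd s {..n}"
    using pq by (intro weight_quotient_mult) (auto intro!: pos dvd)
  moreover have "(snd s {..p + q} * snd s {p + q..n} div snd s {..n}) *
          (snd s {..p} * snd s {p..p + q} div snd s {..p + q}) =
        snd s {..p} * snd s {p + q..n} * snd s {p..p + q} div snd s {..n}"
    using pq by (intro weight_quotient_mult) (auto intro!: pos dvd)
  ultimately have "(snd s {..p} * snd s {p..n} div snd s {..n}) *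
          (snd s {p..p + q} * snd s {p + q..n} div snd s {p..n}) =
        (snd s {..p + q} * snd s {p + q..n} div snd s {..n}) *
          (snd s {..p} * snd s {p..p + q} div snd s {..p + q})"
    by (simp add: mult_ac)
  then have key: "of_nat (snd s {..p} * snd s {p..n} div snd s {..n}) *
          of_nat (snd s {p..p + q} * snd s {p + q..n} div snd s {p..n}) =
        of_nat (snd s {..p + q} * snd s {p + q..n} div snd s {..n}) *
          (of_nat (snd s {..p} * snd s {p..p + q} div snd s {..p + q}) :: 'r)" (is "?x * ?y = ?z * ?w")
    unfolding of_nat_mult[symmetric] by (rule arg_cong)
  have "a * (?x * u) * (?y * v) = a * (?z * (?w * u * v))" for u v
  proof -
    have "a * (?x * u) * (?y * v) = a * u * v * (?x * ?y)"
      by (simp only: mult_ac)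
    also note key
    also have "a * u * v * (?z * ?w) = a * (?z * (?w * u * v))"
      by (simp only: mult_ac)
    finally show ?thesis .
  qed
  then show ?thesis
    unfolding wcap_single b cup back_face_back_face[OF pq] front_face_back_face[OF pq] by simp
qed

lemma wcap_wcap:
  assumes c: "c \<in> wchains n X lam" and pq: "p + q \<le> n"
  shows "wcap (n - p) q (wcap n p c \<phi>) \<psi> = wcap n (p + q) c (wcup p q X lam \<phi> \<psi>)"
  using c
  by (induction rule: wchains_induct) (simp_all add: wcap_wcap_single[OF _ pq] wcap_add)

section \<open>Classes\<close>

lemma wboundaries_zero: "0 \<in> wboundaries n X lam"
  unfolding wboundaries_def by (rule image_eqI[of _ _ 0]) auto

lemma wboundaries_uminus: "b \<in> wboundaries n X lam \<Longrightarrow> - b \<in> wboundaries n X lam"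
  unfolding wboundaries_def
  by (auto simp: wboundary_uminus[symmetric] intro: wchains_uminus)

lemma wboundaries_add:
  "b \<in> wboundaries n X lam \<Longrightarrow> d \<in> wboundaries n X lam \<Longrightarrow> b + d \<in> wboundaries n X lam"
  unfolding wboundaries_def
  by (auto simp: wboundary_add[symmetric] intro: wchains_add)

lemma whomology_class_eq_image: "whomology_class n X lam z = (\<lambda>b. b + z) ` wboundaries n X lam"
  by (auto simp: whomology_class_def r_coset_def wcycle_group_def)

lemma whomology_class_add_boundary:
  assumes b: "b \<in> wboundaries n X lam"
  shows "whomology_class n X lam (b + z) = whomology_class n X lam z"
proof -
  have "d + z = (d + - b) + (b + z)" "d + (b + z) = (d + b) + z" for d
    by simp_all
  then show ?thesis
    unfolding whomology_class_eq_image
    using wboundaries_add wboundaries_uminus[OF b] b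
    by (intro equalityI subsetI; elim imageE) blast+
qed

text \<open>Elements of the class differ from a cycle by a boundary, and boundaries are cycles.
  Hence any element occurring in the union that defines the induced product can be treated as a
  cycle.\<close>

lemma whomology_group_representative:
  assumes "A \<in> carrier (whomology_group n X lam)" "c \<in> A"
  shows "c \<in> wchains n X lam" "wboundary n c = 0"
proof -
  obtain z where z: "z \<in> wchains n X lam" "wboundary n z = 0" "A = whomology_class n X lam z"
    using assms(1)
    by (auto simp: whomology_group_def FactGroup_def RCOSETS_def whomology_class_def wcycle_group_def)
  then obtain e where e: "e \<in> wchains (Suc n) X lam" "c = wboundary (Suc n) e + z"
    using assms(2) by (auto simp: whomology_class_eq_image wboundaries_def)
  show "c \<in> wchains n X lam"
    using e z by (simp add: wchains_add wboundary_in_wchains)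
  show "wboundary n c = 0"
    using e z by (simp add: wboundary_add wboundary_wboundary)
qed

section \<open>Cohomology classes and their representatives\<close>

lemma wcoboundaries_zero: "(\<lambda>c\<in>wchains p X lam. 0) \<in> wcoboundaries p X lam"
proof (cases p)
  case 0
  then show ?thesis
    by (simp add: wcoboundaries_def)
next
  case (Suc k)
  have "(\<lambda>c\<in>wchains k X lam. 0) \<in> wcochains k X lam"
    by (auto simp: wcochains_def wchains_add)
  moreover have "wcoboundary k X lam (\<lambda>c\<in>wchains k X lam. 0) = (\<lambda>c\<in>wchains p X lam. 0)"
    unfolding wcoboundary_def Suc by (intro restrict_ext) (simp add: wboundary_in_wchains)
  ultimately show ?thesis
    unfolding Suc wcoboundaries_def nat.case by (metis image_eqI)
qed

lemma wcohomology_class_eq_image: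
  "wcohomology_class p X lam \<phi> = (\<lambda>b. \<lambda>c\<in>wchains p X lam. b c + \<phi> c) ` wcoboundaries p X lam"
  by (auto simp: wcohomology_class_def r_coset_def wcocycle_group_def)

lemma wcochains_wcoboundary:
  assumes "\<phi> \<in> wcochains p X lam"
  shows "wcoboundary p X lam \<phi> \<in> wcochains (Suc p) X lam"
  using assms
  by (simp add: wcoboundary_def wcochains_def wchains_add wboundary_add wboundary_in_wchains)

text \<open>In degree zero the only coboundary is zero; in positive degree this is dual to the
  vanishing of the double boundary.\<close>

lemma wcoboundaries_cocycle:
  assumes b: "b \<in> wcoboundaries p X lam"
  shows "b \<in> wcochains p X lam" "\<And>c. c \<in> wchains (Suc p) X lam \<Longrightarrow> b (wboundary (Suc p) c) = 0"
proof -
  have "b \<in> wcochains p X lam \<and> (\<forall>c\<in>wchains (Suc p) X lam. b (wboundary (Suc p) c) = 0)"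
  proof (cases p)
    case 0
    then show ?thesis
      using b by (auto simp: wcoboundaries_def wcochains_def wchains_add wboundary_in_wchains)
  next
    case (Suc k)
    then obtain e where e: "e \<in> wcochains k X lam" "b = wcoboundary k X lam e"
      using b by (auto simp: wcoboundaries_def)
    then show ?thesis
      unfolding Suc
      by (simp add: wcochains_wcoboundary)
        (simp add: wcoboundary_def wboundary_in_wchains wboundary_wboundary wcochains_zero)
  qed
  then show "b \<in> wcochains p X lam" "\<And>c. c \<in> wchains (Suc p) X lam \<Longrightarrow> b (wboundary (Suc p) c) = 0"
    by auto
qed

lemma wcohomology_group_representative:
  fixes F :: "('a, 'r::comm_ring_1) wcochain set"
  assumes "F \<in> carrier (wcohomology_group p X lam)" "\<phi> \<in> F"
  shows "\<phi> \<in> wcochains p X lam" "\<And>c. c \<in> wchains (Suc p) X lam \<Longrightarrow> wcoboundary p X lam \<phi> c = 0"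
proof -
  obtain z where z: "z \<in> wcochains p X lam" "wcoboundary p X lam z = (\<lambda>c\<in>wchains (Suc p) X lam. 0)"
      "F = wcohomology_class p X lam z"
    using assms(1)
    by (auto simp: wcohomology_group_def FactGroup_def RCOSETS_def wcohomology_class_def wcocycle_group_def)
  then obtain b where b: "b \<in> wcoboundaries p X lam" "\<phi> = (\<lambda>c\<in>wchains p X lam. b c + z c)"
    using assms(2) by (auto simp: wcohomology_class_eq_image)
  show "\<phi> \<in> wcochains p X lam"
    using z(1) wcoboundaries_cocycle(1)[OF b(1)] by (simp add: b(2) wcochains_def wchains_add)
  fix c :: "'a wsimplex \<Rightarrow>\<^sub>0 int" assume c: "c \<in> wchains (Suc p) X lam"
  have "z (wboundary (Suc p) c) = 0"
    using fun_cong[OF z(2), of c] c by (simp add: wcoboundary_def)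
  then show "wcoboundary p X lam \<phi> c = 0"
    using c by (simp add: b(2) wcoboundary_def wboundary_in_wchains wcoboundaries_cocycle(2)[OF b(1)])
qed

text \<open>If \<open>b\<close> bounds \<open>e\<close>, the cocycle condition removes the
  coboundary term of the Leibniz rule, leaving the boundary of \<open>e\<close> capped with the
  signed \<psi>.\<close>

lemma wcap_wboundary_in_wboundaries:
  assumes b: "b \<in> wboundaries n X lam" and \<psi>: "\<psi> \<in> wcochains q X lam" and qn: "q \<le> n"
    and cocycle: "\<And>c. c \<in> wchains (Suc q) X lam \<Longrightarrow> wcoboundary q X lam \<psi> c = 0"
  shows "wcap n q b \<psi> \<in> wboundaries (n - q) X lam"
proof -
  obtain e where e: "e \<in> wchains (Suc n) X lam" "b = wboundary (Suc n) e"
    using b by (auto simp: wboundaries_def)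
  have "wcap (Suc n) (Suc q) e (wcoboundary q X lam \<psi>) = wcap (Suc n) (Suc q) e (\<lambda>x. 0)"
    using qn by (intro wcap_cochain_cong[OF e(1)] cocycle) auto
  then have "wcap n q b \<psi> = wboundary (Suc (n - q)) (wcap (Suc n) q e (\<lambda>x. (-1) ^ q * \<psi> x))"
    using wboundary_wcap[OF e(1) \<psi> qn] by (simp add: e(2) wcap_cochain_zero)
  moreover have "wcap (Suc n) q e (\<lambda>x. (-1) ^ q * \<psi> x) \<in> wchains (Suc (n - q)) X lam"
    using wcap_in_wchains[OF e(1), of q] qn by (simp add: Suc_diff_le)
  ultimately show ?thesis
    unfolding wboundaries_def by blast
qed

text \<open>Here the Leibniz rule loses its other term, because \<open>c\<close> is a cycle. What
  remains carries a minus sign, absorbed since boundaries are closed under negation.\<close>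

lemma wcap_wcoboundary_in_wboundaries:
  assumes c: "c \<in> wchains n X lam" "wboundary n c = 0" and b: "b \<in> wcoboundaries r X lam"
    and rn: "r \<le> n"
  shows "wcap n r c b \<in> wboundaries (n - r) X lam"
proof (cases r)
  case 0
  then have "wcap n r c b = wcap n r c (\<lambda>x. 0)"
    using b rn by (intro wcap_cochain_cong[OF c(1)]) (auto simp: wcoboundaries_def)
  then show ?thesis
    by (simp add: wcap_cochain_zero wboundaries_zero)
next
  case (Suc k)
  \<comment> \<open>A positive \<open>r \<le> n\<close> forces \<open>n\<close> to be a successor,
    the form in which the Leibniz rule applies; moreover \<open>n - r = m - k\<close>.\<close>
  then obtain m where m: "n = Suc m" "k \<le> m"
    using rn by (cases n) auto
  obtain e where e: "e \<in> wcochains k X lam" "b = wcoboundary k X lam e"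
    using b by (auto simp: wcoboundaries_def Suc)
  have c': "c \<in> wchains (Suc m) X lam" "wboundary (Suc m) c = 0"
    using c by (simp_all add: m)
  have "wboundary (Suc (m - k)) (wcap (Suc m) k c (\<lambda>x. (-1) ^ k * e x)) = - wcap n r c b"
    using wboundary_wcap[OF c'(1) e(1) m(2)] by (simp add: c'(2) e(2) m Suc)
  moreover have "wcap (Suc m) k c (\<lambda>x. (-1) ^ k * e x) \<in> wchains (Suc (m - k)) X lam"
    using wcap_in_wchains[OF c'(1), of k] m(2) by (simp add: Suc_diff_le)
  ultimately have "- wcap n r c b \<in> wboundaries (m - k) X lam"
    unfolding wboundaries_def by (metis image_eqI)
  then show ?thesis
    using wboundaries_uminus by (fastforce simp: m Suc)
qed

theorem corollary5p9:
  fixes X :: "'a topology" and lam :: "'a \<Rightarrow> nat"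
    and A :: "('a wsimplex \<Rightarrow>\<^sub>0 'r::comm_ring_1) set"
    and F G :: "('a, 'r) wcochain set"
    and n p q :: nat
  assumes "descending_weighted_polyhedron TYPE('v::euclidean_space) X lam"
    and "F \<in> carrier (wcohomology_group p X lam)"
    and "G \<in> carrier (wcohomology_group q X lam)"
    and "A \<in> carrier (whomology_group n X lam)"
    and "p + q \<le> n"
  shows "whomology_cap (n - p) q X lam (whomology_cap n p X lam A F) G =
         whomology_cap n (p + q) X lam A (wcohomology_cup p q X lam F G)"
proof -
  let ?cls = "\<lambda>c \<phi> \<psi>. whomology_class (n - (p + q)) X lam (wcap n (p + q) c (wcup p q X lam \<phi> \<psi>))"
  have pn: "q \<le> n - p" "n - p - q = n - (p + q)"
    using assms(5) by auto
  have left: "whomology_class (n - p - q) X lam (wcap (n - p) q d \<psi>) = ?cls c \<phi> \<psi>"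
    if c: "c \<in> A" and \<psi>: "\<psi> \<in> G" and d: "d \<in> whomology_class (n - p) X lam (wcap n p c \<phi>)"
    for c d \<phi> \<psi>
  proof -
    obtain b where b: "b \<in> wboundaries (n - p) X lam" "d = b + wcap n p c \<phi>"
      using d by (auto simp: whomology_class_eq_image)
    have "wcap (n - p) q b \<psi> \<in> wboundaries (n - p - q) X lam"
      using wcohomology_group_representative[OF assms(3) \<psi>] pn
      by (intro wcap_wboundary_in_wboundaries[OF b(1)]) auto
    then show ?thesis
      using wcap_wcap[OF whomology_group_representative(1)[OF assms(4) c] assms(5)]
      by (simp add: b(2) wcap_add whomology_class_add_boundary pn)
  qed
  have right: "whomology_class (n - (p + q)) X lam (wcap n (p + q) c \<eta>) = ?cls c \<phi> \<psi>"
    if c: "c \<in> A" and \<eta>: "\<eta> \<in> wcohomology_class (p + q) X lam (wcup p q X lam \<phi> \<psi>)"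
    for c \<eta> \<phi> \<psi>
  proof -
    note c' = whomology_group_representative[OF assms(4) c]
    obtain b where b: "b \<in> wcoboundaries (p + q) X lam"
        "\<eta> = (\<lambda>x\<in>wchains (p + q) X lam. b x + wcup p q X lam \<phi> \<psi> x)"
      using \<eta> by (auto simp: wcohomology_class_eq_image)
    have "wcap n (p + q) c \<eta> = wcap n (p + q) c (\<lambda>x. b x + wcup p q X lam \<phi> \<psi> x)"
      by (intro wcap_cochain_cong[OF c'(1) assms(5)]) (simp add: b(2))
    then show ?thesis
      using wcap_wcoboundary_in_wboundaries[OF c' b(1) assms(5)]
      by (simp add: wcap_cochain_add whomology_class_add_boundary)
  qed
  \<comment> \<open>A union of one constant class over an index set collapses to that class only if
    the index set is nonempty; \<open>ne\<close> and \<open>ne'\<close> secure this for the two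
    intermediate classes.\<close>
  have ne: "whomology_class (n - p) X lam z \<noteq> {}" for z
    using wboundaries_zero by (auto simp: whomology_class_eq_image)
  have ne': "wcohomology_class (p + q) X lam z \<noteq> {}" for z
    using wcoboundaries_zero by (auto simp: wcohomology_class_eq_image)
  \<comment> \<open>The chain below brings both sides to one union over \<open>c\<close>, \<phi> and
    \<psi> of the classes \<open>?cls\<close>; no comparison between different triples is
    required.\<close>
  have "whomology_cap (n - p) q X lam (whomology_cap n p X lam A F) G =
      (\<Union>c\<in>A. \<Union>\<phi>\<in>F. \<Union>d\<in>whomology_class (n - p) X lam (wcap n p c \<phi>). \<Union>\<psi>\<in>G.
         whomology_class (n - p - q) X lam (wcap (n - p) q d \<psi>))"
    unfolding whomology_cap_def by blast
  also have "\<dots> = (\<Union>c\<in>A. \<Union>\<phi>\<in>F. \<Union>d\<in>whomology_class (n - p) X lam (wcap n p c \<phi>). \<Union>\<psi>\<in>G. ?cls c \<phi> \<psi>)"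
    by (intro SUP_cong refl left)
  also have "\<dots> = (\<Union>c\<in>A. \<Union>\<phi>\<in>F. \<Union>\<psi>\<in>G. ?cls c \<phi> \<psi>)"
    by (simp only: cSUP_const[OF ne])
  also have "\<dots> = (\<Union>c\<in>A. \<Union>\<phi>\<in>F. \<Union>\<psi>\<in>G. \<Union>\<eta>\<in>wcohomology_class (p + q) X lam (wcup p q X lam \<phi> \<psi>). ?cls c \<phi> \<psi>)"
    by (simp only: cSUP_const[OF ne'])
  also have "\<dots> = (\<Union>c\<in>A. \<Union>\<phi>\<in>F. \<Union>\<psi>\<in>G. \<Union>\<eta>\<in>wcohomology_class (p + q) X lam (wcup p q X lam \<phi> \<psi>).
      whomology_class (n - (p + q)) X lam (wcap n (p + q) c \<eta>))"
    by (intro SUP_cong refl right[symmetric])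
  also have "\<dots> = whomology_cap n (p + q) X lam A (wcohomology_cup p q X lam F G)"
    unfolding whomology_cap_def wcohomology_cup_def by blast
  finally show ?thesis .
qed

end
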